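(* Let $I=(0,1)$ and let $\tilde u,H\in L^\infty(I)$ be real-valued with $\inf_IH>0$. Let $A_0:L^2(I)^2\to L^2(I)^2$ be the bounded operator $$A_0\begin{pmatrix}\phi_1\\ \phi_2\end{pmatrix}=\begin{pmatrix}\tilde u\,\phi_1+H\phi_2\\ g\int_0^1\phi_1\,\mathrm{d}\lambda+\tilde u\,\phi_2\end{pmatrix}.$$ Then the spectrum of $A_0$ is characterized by $$\sigma_d(A_0)=\left\{c\in\mathbb{C}\setminus\tilde u[I]:\int_0^1\frac{gH}{(c-\tilde u)^2}\,\mathrm{d}\lambda=1\right\},\qquad \sigma_e(A_0)=\tilde u[I].$$
   Context: $g>0$ is a constant; $L^2(I)$ is the space of complex-valued square integrable functions; $\inf_I$ is the essential infimum. For a bounded operator $A$ and $\mathbf{I}$ the identity: the discrete spectrum $\sigma_d(A)$ is the set of $c\in\mathbb{C}$ such that $A-c\mathbf{I}$ is not invertible but Fredholm; the essential spectrum $\sigma_e(A)$ is the set of $c\in\mathbb{C}$ such that $A-c\mathbf{I}$ is not Fredholm. The essential range $\tilde u[I]$ is the set of $c\in\mathbb{R}$ such that for all $\varepsilon>0$ the set $\{\lambda\in I:|\tilde u(\lambda)-c|<\varepsilon\}$ has non-zero measure. *)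

theory Defs
  imports "HOL-Analysis.Analysis" "HOL-Probability.Essential_Supremum"
begin

section \<open>Complex normed spaces and their bounded operators\<close>

class complex_normed_vector = real_normed_vector +
  fixes scaleC :: "complex \<Rightarrow> 'a \<Rightarrow> 'a"  (infixr "*\<^sub>C" 75)
  assumes scaleC_add_right: "c *\<^sub>C (x + y) = c *\<^sub>C x + c *\<^sub>C y"
    and scaleC_add_left: "(c + d) *\<^sub>C x = c *\<^sub>C x + d *\<^sub>C x"
    and scaleC_scaleC: "c *\<^sub>C d *\<^sub>C x = (c * d) *\<^sub>C x"
    and scaleC_of_real: "complex_of_real r *\<^sub>C x = r *\<^sub>R x"
    and norm_scaleC: "norm (c *\<^sub>C x) = cmod c * norm x"

lemma scaleC_one: "1 *\<^sub>C x = (x :: 'a :: complex_normed_vector)"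
  using scaleC_of_real[of 1 x] by simp

global_interpretation complex_vector:
  vector_space "scaleC :: complex \<Rightarrow> 'a \<Rightarrow> 'a :: complex_normed_vector"
  defines cspan = complex_vector.span
  by unfold_locales (simp_all add: scaleC_add_right scaleC_add_left scaleC_scaleC scaleC_one)

instantiation prod :: (complex_normed_vector, complex_normed_vector) complex_normed_vector
begin

definition scaleC_prod_def: "c *\<^sub>C p = (c *\<^sub>C fst p, c *\<^sub>C snd p)"

instance
proof
  fix c d :: complex and r :: real and x y :: "'a \<times> 'b"
  show "c *\<^sub>C (x + y) = c *\<^sub>C x + c *\<^sub>C y"
    by (simp add: scaleC_prod_def scaleC_add_right)
  show "(c + d) *\<^sub>C x = c *\<^sub>C x + d *\<^sub>C x"
    by (simp add: scaleC_prod_def scaleC_add_left)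
  show "c *\<^sub>C d *\<^sub>C x = (c * d) *\<^sub>C x"
    by (simp add: scaleC_prod_def scaleC_scaleC)
  show "complex_of_real r *\<^sub>C x = r *\<^sub>R x"
    by (simp add: scaleC_prod_def scaleC_of_real scaleR_prod_def)
  have "(norm (c *\<^sub>C x))\<^sup>2 = (cmod c * norm x)\<^sup>2"
    by (simp add: scaleC_prod_def norm_prod_def norm_scaleC power_mult_distrib distrib_left)
  then show "norm (c *\<^sub>C x) = cmod c * norm x"
    by (metis norm_ge_zero mult_nonneg_nonneg power2_eq_imp_eq)
qed

end

definition bounded_clinear ::
    "('a :: complex_normed_vector \<Rightarrow> 'b :: complex_normed_vector) \<Rightarrow> bool"
  where "bounded_clinear A \<longleftrightarrow> bounded_linear A \<and> (\<forall>c x. A (c *\<^sub>C x) = c *\<^sub>C A x)"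

definition invertible_op ::
    "('a :: complex_normed_vector \<Rightarrow> 'b :: complex_normed_vector) \<Rightarrow> bool"
  where "invertible_op A \<longleftrightarrow> bounded_clinear A \<and>
    (\<exists>B. bounded_clinear B \<and> (\<forall>x. B (A x) = x) \<and> (\<forall>y. A (B y) = y))"

text \<open>Finite-dimensional kernel, closed range, finite-dimensional cokernel. (Between Banach spaces
  closedness of the range follows from the finite dimension of the cokernel.)\<close>

definition fredholm_op ::
    "('a :: complex_normed_vector \<Rightarrow> 'b :: complex_normed_vector) \<Rightarrow> bool"
  where "fredholm_op A \<longleftrightarrow> bounded_clinear A \<and>
    (\<exists>K. finite K \<and> {x. A x = 0} \<subseteq> cspan K) \<and>
    closed (range A) \<and>
    (\<exists>C. finite C \<and> (\<forall>y. \<exists>x. \<exists>z \<in> cspan C. y = A x + z))"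

definition discrete_spectrum :: "('a :: complex_normed_vector \<Rightarrow> 'a) \<Rightarrow> complex set"
  where "discrete_spectrum A =
    {c. \<not> invertible_op (\<lambda>x. A x - c *\<^sub>C x) \<and> fredholm_op (\<lambda>x. A x - c *\<^sub>C x)}"

definition essential_spectrum :: "('a :: complex_normed_vector \<Rightarrow> 'a) \<Rightarrow> complex set"
  where "essential_spectrum A = {c. \<not> fredholm_op (\<lambda>x. A x - c *\<^sub>C x)}"


section \<open>Essentially bounded real functions\<close>

abbreviation unit_leb :: "real measure"
  where "unit_leb \<equiv> lebesgue_on {0<..<1}"

definition Linfty :: "'a measure \<Rightarrow> ('a \<Rightarrow> real) set"
  where "Linfty M = {f \<in> borel_measurable M. esssup M (\<lambda>x. ereal \<bar>f x\<bar>) < \<infinity>}"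

definition essinf :: "'a measure \<Rightarrow> ('a \<Rightarrow> real) \<Rightarrow> ereal"
  where "essinf M f = - esssup M (\<lambda>x. - ereal (f x))"

definition essential_range :: "'a measure \<Rightarrow> ('a \<Rightarrow> real) \<Rightarrow> real set"
  where "essential_range M f = {c. \<forall>\<epsilon>>0. emeasure M {x \<in> space M. \<bar>f x - c\<bar> < \<epsilon>} \<noteq> 0}"

lemma Linfty_bounded:
  assumes "f \<in> Linfty M"
  obtains b where "0 \<le> b" "AE x in M. \<bar>f x\<bar> \<le> b"
proof -
  have less: "esssup M (\<lambda>x. ereal \<bar>f x\<bar>) < \<infinity>"
    using assms by (simp add: Linfty_def)
  obtain z where z: "esssup M (\<lambda>x. ereal \<bar>f x\<bar>) < z" "z < \<infinity>"
    using less dense by blast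
  have ae: "AE x in M. ereal \<bar>f x\<bar> \<le> esssup M (\<lambda>x. ereal \<bar>f x\<bar>)"
    by (rule esssup_AE)
  have "AE x in M. \<bar>f x\<bar> \<le> max 0 (real_of_ereal z)"
    using ae
  proof eventually_elim
    case (elim x)
    then have "ereal \<bar>f x\<bar> < z" using z by order
    then show ?case using z by (cases z) auto
  qed
  then show thesis by (intro that[of "max 0 (real_of_ereal z)"]) auto
qed


section \<open>The Hilbert space of square integrable functions on the unit interval\<close>

definition square_integrable :: "(real \<Rightarrow> complex) \<Rightarrow> bool"
  where "square_integrable f \<longleftrightarrow>
    f \<in> borel_measurable unit_leb \<and> integrable unit_leb (\<lambda>x. (cmod (f x))\<^sup>2)"

lemma square_integrable_0: "square_integrable (\<lambda>_. 0)"
  by (simp add: square_integrable_def)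

lemma square_integrable_bound:
  assumes f: "square_integrable f" and g: "g \<in> borel_measurable unit_leb"
    and b: "AE x in unit_leb. cmod (g x) \<le> b * cmod (f x)"
  shows "square_integrable g"
proof -
  have [measurable]: "f \<in> borel_measurable unit_leb" "g \<in> borel_measurable unit_leb"
    using f g by (auto simp: square_integrable_def)
  have i: "integrable unit_leb (\<lambda>x. b\<^sup>2 * (cmod (f x))\<^sup>2)"
    using f by (simp add: square_integrable_def)
  have "integrable unit_leb (\<lambda>x. (cmod (g x))\<^sup>2)"
  proof (rule Bochner_Integration.integrable_bound[OF i])
    show "AE x in unit_leb. norm ((cmod (g x))\<^sup>2) \<le> norm (b\<^sup>2 * (cmod (f x))\<^sup>2)"
      using b
    proof eventually_elim
      case (elim x)
      then have "(cmod (g x))\<^sup>2 \<le> (b * cmod (f x))\<^sup>2" by (intro power_mono) auto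
      then show ?case by (simp add: power_mult_distrib)
    qed
  qed measurable
  then show ?thesis using g by (simp add: square_integrable_def)
qed

lemma square_integrable_add:
  assumes "square_integrable f" "square_integrable g"
  shows "square_integrable (\<lambda>x. f x + g x)"
proof -
  have [measurable]: "f \<in> borel_measurable unit_leb" "g \<in> borel_measurable unit_leb"
    using assms by (auto simp: square_integrable_def)
  have i: "integrable unit_leb (\<lambda>x. 2 * (cmod (f x))\<^sup>2 + 2 * (cmod (g x))\<^sup>2)"
    using assms by (simp add: square_integrable_def)
  have le: "(cmod (a + b))\<^sup>2 \<le> 2 * (cmod a)\<^sup>2 + 2 * (cmod b)\<^sup>2" for a b :: complex
  proof -
    have "(cmod (a + b))\<^sup>2 \<le> (cmod a + cmod b)\<^sup>2"
      by (intro power_mono norm_triangle_ineq) auto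
    also have "\<dots> \<le> 2 * (cmod a)\<^sup>2 + 2 * (cmod b)\<^sup>2"
      using sum_squares_ge_zero[of "cmod a - cmod b" 0]
      by (simp add: power2_eq_square algebra_simps)
    finally show ?thesis .
  qed
  have "integrable unit_leb (\<lambda>x. (cmod (f x + g x))\<^sup>2)"
    by (rule Bochner_Integration.integrable_bound[OF i]) (auto intro!: AE_I2 order_trans[OF le])
  then show ?thesis by (simp add: square_integrable_def)
qed

lemma square_integrable_cmult:
  assumes "square_integrable f"
  shows "square_integrable (\<lambda>x. c * f x)"
  using assms
  by (intro square_integrable_bound[OF assms, where b = "cmod c"])
     (auto simp: square_integrable_def norm_mult)

lemma square_integrable_Linfty_mult:
  assumes "square_integrable f" "h \<in> Linfty unit_leb"
  shows "square_integrable (\<lambda>x. complex_of_real (h x) * f x)"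
proof -
  obtain b where b: "AE x in unit_leb. \<bar>h x\<bar> \<le> b"
    using Linfty_bounded[OF assms(2)] .
  have [measurable]: "f \<in> borel_measurable unit_leb" "h \<in> borel_measurable unit_leb"
    using assms by (auto simp: square_integrable_def Linfty_def)
  show ?thesis
  proof (rule square_integrable_bound[OF assms(1), where b = b])
    show "AE x in unit_leb. cmod (complex_of_real (h x) * f x) \<le> b * cmod (f x)"
      using b by eventually_elim (simp add: norm_mult mult_right_mono)
  qed measurable
qed

lemma emeasure_unit_leb: "emeasure unit_leb (space unit_leb) = 1"
  by (simp add: emeasure_restrict_space)

lemma finite_measure_unit_leb: "finite_measure unit_leb"
  by (rule finite_measureI, subst emeasure_unit_leb) simp

lemma square_integrable_const: "square_integrable (\<lambda>_. c)"
  using finite_measure_unit_leb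
  by (simp add: square_integrable_def finite_measure.integrable_const)

lemma square_integrable_inner:
  assumes "square_integrable f" "square_integrable g"
  shows "integrable unit_leb (\<lambda>x. f x \<bullet> g x)"
proof -
  have [measurable]: "f \<in> borel_measurable unit_leb" "g \<in> borel_measurable unit_leb"
    using assms by (auto simp: square_integrable_def)
  have i: "integrable unit_leb (\<lambda>x. (cmod (f x))\<^sup>2 + (cmod (g x))\<^sup>2)"
    using assms by (simp add: square_integrable_def)
  have le: "\<bar>a \<bullet> b\<bar> \<le> (cmod a)\<^sup>2 + (cmod b)\<^sup>2" for a b :: complex
  proof -
    have "\<bar>a \<bullet> b\<bar> \<le> cmod a * cmod b" by (rule Cauchy_Schwarz_ineq2)
    also have "\<dots> \<le> (cmod a)\<^sup>2 + (cmod b)\<^sup>2"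
      using sum_squares_bound[of "cmod a" "cmod b"] mult_nonneg_nonneg[of "cmod a" "cmod b"]
      unfolding mult.assoc by (smt (verit) norm_ge_zero)
    finally show ?thesis .
  qed
  show ?thesis
    by (rule Bochner_Integration.integrable_bound[OF i]) (auto intro!: AE_I2 order_trans[OF le])
qed

quotient_type L2 = "real \<Rightarrow> complex" / partial:
  "\<lambda>f g. square_integrable f \<and> square_integrable g \<and> (AE x in unit_leb. f x = g x)"
proof (rule part_equivpI)
  show "\<exists>f. square_integrable f \<and> square_integrable f \<and> (AE x in unit_leb. f x = f x)"
    using square_integrable_0 by auto
  show "symp (\<lambda>f g. square_integrable f \<and> square_integrable g \<and> (AE x in unit_leb. f x = g x))"
    by (rule sympI) (auto simp: eq_commute)
  show "transp (\<lambda>f g. square_integrable f \<and> square_integrable g \<and> (AE x in unit_leb. f x = g x))"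
    by (rule transpI) (auto elim: eventually_elim2)
qed

instantiation L2 :: real_inner
begin

lift_definition zero_L2 :: L2 is "\<lambda>_. 0"
  by (simp add: square_integrable_0)

lift_definition plus_L2 :: "L2 \<Rightarrow> L2 \<Rightarrow> L2" is "\<lambda>f g x. f x + g x"
  by (auto intro: square_integrable_add elim: eventually_elim2)

lift_definition uminus_L2 :: "L2 \<Rightarrow> L2" is "\<lambda>f x. - f x"
  using square_integrable_cmult[of _ "-1"] by auto

definition minus_L2 :: "L2 \<Rightarrow> L2 \<Rightarrow> L2" where "minus_L2 \<phi> \<psi> = \<phi> + - \<psi>"

lift_definition scaleR_L2 :: "real \<Rightarrow> L2 \<Rightarrow> L2" is "\<lambda>r f x. complex_of_real r * f x"
  by (auto intro: square_integrable_cmult)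

text \<open>The real part of the usual sesquilinear product; it induces the same norm.\<close>

lift_definition inner_L2 :: "L2 \<Rightarrow> L2 \<Rightarrow> real" is "\<lambda>f g. LINT x|unit_leb. f x \<bullet> g x"
proof -
  fix f f' g g' :: "real \<Rightarrow> complex"
  assume 1: "square_integrable f \<and> square_integrable f' \<and> (AE x in unit_leb. f x = f' x)"
    and 2: "square_integrable g \<and> square_integrable g' \<and> (AE x in unit_leb. g x = g' x)"
  then have m: "(\<lambda>x. f x \<bullet> g x) \<in> borel_measurable unit_leb"
      "(\<lambda>x. f' x \<bullet> g' x) \<in> borel_measurable unit_leb"
    using square_integrable_inner[THEN borel_measurable_integrable] by auto
  have "AE x in unit_leb. f x = f' x" "AE x in unit_leb. g x = g' x" using 1 2 by auto
  then have "AE x in unit_leb. f x \<bullet> g x = f' x \<bullet> g' x" by eventually_elim simp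
  with m show "(LINT x|unit_leb. f x \<bullet> g x) = (LINT x|unit_leb. f' x \<bullet> g' x)"
    by (intro integral_cong_AE) auto
qed

definition norm_L2 :: "L2 \<Rightarrow> real" where "norm_L2 \<phi> = sqrt (\<phi> \<bullet> \<phi>)"
definition dist_L2 :: "L2 \<Rightarrow> L2 \<Rightarrow> real" where "dist_L2 \<phi> \<psi> = norm (\<phi> - \<psi>)"
definition sgn_L2 :: "L2 \<Rightarrow> L2" where "sgn_L2 \<phi> = inverse (norm \<phi>) *\<^sub>R \<phi>"
definition uniformity_L2 :: "(L2 \<times> L2) filter"
  where "uniformity_L2 = (INF e\<in>{0<..}. principal {(\<phi>, \<psi>). dist \<phi> \<psi> < e})"
definition open_L2 :: "L2 set \<Rightarrow> bool"
  where "open_L2 U = (\<forall>\<phi>\<in>U. \<forall>\<^sub>F (\<phi>', \<psi>) in uniformity. \<phi>' = \<phi> \<longrightarrow> \<psi> \<in> U)"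

instance
proof
  fix a b c x y z :: L2 and r s :: real
  show "a + b + c = a + (b + c)"
    by transfer (auto intro!: square_integrable_add simp: add.assoc)
  show "a + b = b + a"
    by transfer (auto intro!: square_integrable_add simp: add.commute)
  show "0 + a = a" by transfer simp
  show "- a + a = 0" by transfer (simp add: square_integrable_0)
  show "a - b = a + - b" by (rule minus_L2_def)
  show "r *\<^sub>R (a + b) = r *\<^sub>R a + r *\<^sub>R b"
    by transfer (auto intro!: square_integrable_add square_integrable_cmult simp: distrib_left)
  show "(r + s) *\<^sub>R a = r *\<^sub>R a + s *\<^sub>R a"
    by transfer
      (auto intro!: square_integrable_add square_integrable_cmult simp: distrib_right
        simp del: of_real_add simp: of_real_add)
  show "r *\<^sub>R s *\<^sub>R a = (r * s) *\<^sub>R a"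
    by transfer (auto intro!: square_integrable_cmult simp: mult.assoc)
  show "1 *\<^sub>R a = a" by transfer simp
  show "dist a b = norm (a - b)" by (rule dist_L2_def)
  show "sgn a = inverse (norm a) *\<^sub>R a" by (rule sgn_L2_def)
  show "uniformity = (INF e\<in>{0<..}. principal {(\<phi>, \<psi>). dist (\<phi> :: L2) \<psi> < e})"
    by (rule uniformity_L2_def)
  show "open U = (\<forall>\<phi>\<in>U. \<forall>\<^sub>F (\<phi>', \<psi>) in uniformity. \<phi>' = \<phi> \<longrightarrow> \<psi> \<in> U)" for U :: "L2 set"
    by (rule open_L2_def)
  show "x \<bullet> y = y \<bullet> x" by transfer (simp add: inner_commute)
  show "(x + y) \<bullet> z = x \<bullet> z + y \<bullet> z"
    by transfer (simp add: inner_add_left square_integrable_inner)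
  show "(r *\<^sub>R x) \<bullet> y = r * (x \<bullet> y)"
    by transfer (simp add: scaleR_conv_of_real[symmetric])
  show "0 \<le> x \<bullet> x" by transfer simp
  show "x \<bullet> x = 0 \<longleftrightarrow> x = 0"
  proof transfer
    fix f assume f: "square_integrable f \<and> square_integrable f \<and> (AE x in unit_leb. f x = f x)"
    then have "integrable unit_leb (\<lambda>x. f x \<bullet> f x)" by (simp add: square_integrable_inner)
    then have "(LINT x|unit_leb. f x \<bullet> f x) = 0 \<longleftrightarrow> (AE x in unit_leb. f x \<bullet> f x = 0)"
      by (intro integral_nonneg_eq_0_iff_AE) auto
    then show "(LINT x|unit_leb. f x \<bullet> f x) = 0 \<longleftrightarrow>
        square_integrable f \<and> square_integrable (\<lambda>_. 0) \<and> (AE x in unit_leb. f x = 0)"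
      using f by (simp add: square_integrable_0)
  qed
  show "norm x = sqrt (x \<bullet> x)" by (rule norm_L2_def)
qed

end

instantiation L2 :: complex_normed_vector
begin

lift_definition scaleC_L2 :: "complex \<Rightarrow> L2 \<Rightarrow> L2" is "\<lambda>c f x. c * f x"
  by (auto intro: square_integrable_cmult)

instance
proof
  fix c d :: complex and r :: real and x y :: L2
  show "c *\<^sub>C (x + y) = c *\<^sub>C x + c *\<^sub>C y"
    by transfer (auto intro!: square_integrable_add square_integrable_cmult simp: distrib_left)
  show "(c + d) *\<^sub>C x = c *\<^sub>C x + d *\<^sub>C x"
    by transfer (auto intro!: square_integrable_add square_integrable_cmult simp: distrib_right)
  show "c *\<^sub>C d *\<^sub>C x = (c * d) *\<^sub>C x"
    by transfer (auto intro!: square_integrable_cmult simp: mult.assoc)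
  show "complex_of_real r *\<^sub>C x = r *\<^sub>R x"
    by transfer (auto intro!: square_integrable_cmult)
  have "(c *\<^sub>C x) \<bullet> (c *\<^sub>C x) = (cmod c)\<^sup>2 * (x \<bullet> x)"
    by transfer (simp add: power2_norm_eq_inner[symmetric] norm_mult power_mult_distrib)
  then show "norm (c *\<^sub>C x) = cmod c * norm x"
    by (simp add: norm_eq_sqrt_inner real_sqrt_mult)
qed

end

lemma norm_L2_eq:
  "norm \<phi> = sqrt (LINT x|unit_leb. (cmod (rep_L2 \<phi> x))\<^sup>2)"
  by (simp add: norm_eq_sqrt_inner inner_L2.rep_eq power2_norm_eq_inner)


section \<open>The operator\<close>

text \<open>Here \<open>rep_L2 \<phi>\<close> is some representative of the class \<open>\<phi>\<close>, and \<open>abs_L2 f\<close> is the class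
  of the square integrable function \<open>f\<close>.\<close>

definition op_A0 :: "real \<Rightarrow> (real \<Rightarrow> real) \<Rightarrow> (real \<Rightarrow> real) \<Rightarrow> L2 \<times> L2 \<Rightarrow> L2 \<times> L2"
  where "op_A0 g u H = (\<lambda>(\<phi>\<^sub>1, \<phi>\<^sub>2).
    (abs_L2 (\<lambda>x. complex_of_real (u x) * rep_L2 \<phi>\<^sub>1 x + complex_of_real (H x) * rep_L2 \<phi>\<^sub>2 x),
     abs_L2 (\<lambda>x. complex_of_real g * (LINT y|unit_leb. rep_L2 \<phi>\<^sub>1 y)
                 + complex_of_real (u x) * rep_L2 \<phi>\<^sub>2 x)))"

lemma square_integrable_rep: "square_integrable (rep_L2 \<phi>)"
  using Quotient3_rep_reflp[OF Quotient3_L2] by blast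

lemma abs_rep_L2: "abs_L2 (rep_L2 \<phi>) = \<phi>"
  by (rule Quotient3_abs_rep[OF Quotient3_L2])

lemma abs_L2_eqI:
  assumes "square_integrable f" "square_integrable f'" "AE x in unit_leb. f x = f' x"
  shows "abs_L2 f = abs_L2 f'"
  using Quotient3_rel_abs[OF Quotient3_L2] assms by blast

lemma rep_abs_L2:
  assumes "square_integrable f"
  shows "AE x in unit_leb. rep_L2 (abs_L2 f) x = f x"
  using rep_abs_rsp_left[OF Quotient3_L2, of f f] assms by auto

lemma abs_L2_add:
  assumes "square_integrable f" "square_integrable f'"
  shows "abs_L2 f + abs_L2 f' = abs_L2 (\<lambda>x. f x + f' x)"
  by (rule plus_L2.abs_eq) (use assms in auto)

lemma abs_L2_scaleC:
  assumes "square_integrable f"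
  shows "c *\<^sub>C abs_L2 f = abs_L2 (\<lambda>x. c * f x)"
  by (rule scaleC_L2.abs_eq) (use assms in auto)

lemma inner_abs_L2:
  assumes "square_integrable f" "square_integrable f'"
  shows "abs_L2 f \<bullet> abs_L2 f' = (LINT x|unit_leb. f x \<bullet> f' x)"
  by (rule inner_L2.abs_eq) (use assms in auto)

lemma rep_L2_add: "AE x in unit_leb. rep_L2 (\<phi> + \<psi>) x = rep_L2 \<phi> x + rep_L2 \<psi> x"
  using rep_abs_L2[OF square_integrable_add[OF square_integrable_rep square_integrable_rep]]
    abs_L2_add[OF square_integrable_rep square_integrable_rep]
  by (simp add: abs_rep_L2)

lemma rep_L2_scaleC: "AE x in unit_leb. rep_L2 (c *\<^sub>C \<phi>) x = c * rep_L2 \<phi> x"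
  using rep_abs_L2[OF square_integrable_cmult[OF square_integrable_rep]]
    abs_L2_scaleC[OF square_integrable_rep]
  by (simp add: abs_rep_L2)

lemma square_integrable_integrable:
  assumes "square_integrable f"
  shows "integrable unit_leb f"
proof -
  have [measurable]: "f \<in> borel_measurable unit_leb"
    using assms by (simp add: square_integrable_def)
  have i: "integrable unit_leb (\<lambda>x. 1 + (cmod (f x))\<^sup>2)"
    using assms finite_measure_unit_leb
    by (simp add: square_integrable_def finite_measure.integrable_const)
  have le: "t \<le> 1 + t\<^sup>2" for t :: real
    using zero_le_power2[of "t - 1"] zero_le_power2[of t]
    unfolding power2_diff one_power2 mult_1_right by linarith
  show ?thesis
    by (rule Bochner_Integration.integrable_bound[OF i]) (use le in auto)
qed

lemma norm_abs_L2_const: "norm (abs_L2 (\<lambda>_. c)) = cmod c"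
proof -
  have "measure unit_leb (space unit_leb) = 1"
    unfolding measure_def emeasure_unit_leb by simp
  then show ?thesis
    by (simp add: norm_eq_sqrt_inner inner_abs_L2 square_integrable_const
        del: space_restrict_space)
qed

lemma cmod_integral_le: "cmod (LINT x|unit_leb. rep_L2 \<phi> x) \<le> 2 * norm \<phi>"
proof -
  note n = norm_abs_L2_const
  have i: "integrable unit_leb (rep_L2 \<phi>)"
    by (intro square_integrable_integrable square_integrable_rep)
  have e: "\<phi> \<bullet> abs_L2 (\<lambda>_. c) = (LINT x|unit_leb. rep_L2 \<phi> x \<bullet> c)" for c
    using inner_abs_L2[OF square_integrable_rep square_integrable_const]
    by (simp add: abs_rep_L2)
  have "\<bar>Re (LINT x|unit_leb. rep_L2 \<phi> x)\<bar> \<le> norm \<phi>"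
    using Cauchy_Schwarz_ineq2[of \<phi> "abs_L2 (\<lambda>_. 1)"] i
    by (simp add: n e inner_complex_def)
  moreover have "\<bar>Im (LINT x|unit_leb. rep_L2 \<phi> x)\<bar> \<le> norm \<phi>"
    using Cauchy_Schwarz_ineq2[of \<phi> "abs_L2 (\<lambda>_. \<i>)"] i
    by (simp add: n e inner_complex_def)
  ultimately show ?thesis
    using cmod_le[of "LINT x|unit_leb. rep_L2 \<phi> x"] by linarith
qed

lemma bounded_clinearI:
  fixes A :: "'a :: complex_normed_vector \<Rightarrow> 'b :: complex_normed_vector"
  assumes "\<And>x y. A (x + y) = A x + A y" "\<And>c x. A (c *\<^sub>C x) = c *\<^sub>C A x"
    "\<And>x. norm (A x) \<le> norm x * K"
  shows "bounded_clinear A"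
proof -
  have "A (r *\<^sub>R x) = r *\<^sub>R A x" for r x
    by (simp add: assms(2) scaleC_of_real[symmetric])
  then show ?thesis
    unfolding bounded_clinear_def using assms by (metis bounded_linear_intro)
qed

lemma bounded_clinear_mult:
  assumes h: "h \<in> Linfty unit_leb"
  shows "bounded_clinear (\<lambda>\<phi>. abs_L2 (\<lambda>x. complex_of_real (h x) * rep_L2 \<phi> x))"
proof -
  note si = square_integrable_Linfty_mult[OF square_integrable_rep h]
  obtain b where b: "0 \<le> b" "AE x in unit_leb. \<bar>h x\<bar> \<le> b"
    using Linfty_bounded[OF h] .
  show ?thesis
  proof (rule bounded_clinearI[where K = b])
    fix \<phi> \<psi> :: L2
    have "AE x in unit_leb. complex_of_real (h x) * rep_L2 (\<phi> + \<psi>) x =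
        complex_of_real (h x) * rep_L2 \<phi> x + complex_of_real (h x) * rep_L2 \<psi> x"
      using rep_L2_add[of \<phi> \<psi>] by eventually_elim (simp add: distrib_left)
    then show "abs_L2 (\<lambda>x. complex_of_real (h x) * rep_L2 (\<phi> + \<psi>) x) =
        abs_L2 (\<lambda>x. complex_of_real (h x) * rep_L2 \<phi> x) +
        abs_L2 (\<lambda>x. complex_of_real (h x) * rep_L2 \<psi> x)"
      unfolding abs_L2_add[OF si si] by (intro abs_L2_eqI si square_integrable_add)
  next
    fix c and \<phi> :: L2
    have "AE x in unit_leb. complex_of_real (h x) * rep_L2 (c *\<^sub>C \<phi>) x =
        c * (complex_of_real (h x) * rep_L2 \<phi> x)"
      using rep_L2_scaleC[of c \<phi>] by eventually_elim simp
    then show "abs_L2 (\<lambda>x. complex_of_real (h x) * rep_L2 (c *\<^sub>C \<phi>) x) =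
        c *\<^sub>C abs_L2 (\<lambda>x. complex_of_real (h x) * rep_L2 \<phi> x)"
      unfolding abs_L2_scaleC[OF si] by (intro abs_L2_eqI si square_integrable_cmult)
  next
    fix \<phi> :: L2
    have "(LINT x|unit_leb. (cmod (complex_of_real (h x) * rep_L2 \<phi> x))\<^sup>2)
        \<le> (LINT x|unit_leb. b\<^sup>2 * (cmod (rep_L2 \<phi> x))\<^sup>2)"
    proof (rule integral_mono_AE)
      show "AE x in unit_leb. (cmod (complex_of_real (h x) * rep_L2 \<phi> x))\<^sup>2
          \<le> b\<^sup>2 * (cmod (rep_L2 \<phi> x))\<^sup>2"
        using b(2)
      proof eventually_elim
        case (elim x)
        then have "\<bar>h x\<bar>\<^sup>2 \<le> b\<^sup>2" by (intro power_mono) auto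
        then show ?case by (simp add: norm_mult power_mult_distrib mult_right_mono)
      qed
    qed (use si[of \<phi>] square_integrable_rep[of \<phi>] in
        \<open>auto simp only: square_integrable_def intro!: integrable_mult_right\<close>)
    also have "\<dots> = b\<^sup>2 * (norm \<phi>)\<^sup>2"
      by (simp add: norm_L2_eq)
    finally have "(norm (abs_L2 (\<lambda>x. complex_of_real (h x) * rep_L2 \<phi> x)))\<^sup>2 \<le> (norm \<phi> * b)\<^sup>2"
      using inner_abs_L2[OF si si, of \<phi> \<phi>]
      by (simp add: power2_norm_eq_inner power_mult_distrib mult.commute)
    then show "norm (abs_L2 (\<lambda>x. complex_of_real (h x) * rep_L2 \<phi> x)) \<le> norm \<phi> * b"
      using b(1) by (meson norm_ge_zero mult_nonneg_nonneg power2_le_imp_le)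
  qed
qed

lemma bounded_clinear_mean:
  "bounded_clinear (\<lambda>\<phi>. abs_L2 (\<lambda>_. complex_of_real g * (LINT y|unit_leb. rep_L2 \<phi> y)))"
proof (rule bounded_clinearI[where K = "2 * \<bar>g\<bar>"])
  have i: "integrable unit_leb (rep_L2 \<phi>)" for \<phi>
    by (intro square_integrable_integrable square_integrable_rep)
  note m = borel_measurable_integrable[OF i]
  fix \<phi> \<psi> :: L2 and c
  have "(LINT y|unit_leb. rep_L2 (\<phi> + \<psi>) y) =
      (LINT y|unit_leb. rep_L2 \<phi> y + rep_L2 \<psi> y)"
    by (intro integral_cong_AE rep_L2_add borel_measurable_add m)
  then show "abs_L2 (\<lambda>_. complex_of_real g * (LINT y|unit_leb. rep_L2 (\<phi> + \<psi>) y)) =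
      abs_L2 (\<lambda>_. complex_of_real g * (LINT y|unit_leb. rep_L2 \<phi> y)) +
      abs_L2 (\<lambda>_. complex_of_real g * (LINT y|unit_leb. rep_L2 \<psi> y))"
    by (simp add: abs_L2_add square_integrable_const i distrib_left)
  have "(LINT y|unit_leb. rep_L2 (c *\<^sub>C \<phi>) y) = (LINT y|unit_leb. c * rep_L2 \<phi> y)"
    by (intro integral_cong_AE rep_L2_scaleC borel_measurable_times borel_measurable_const m)
  then show "abs_L2 (\<lambda>_. complex_of_real g * (LINT y|unit_leb. rep_L2 (c *\<^sub>C \<phi>) y)) =
      c *\<^sub>C abs_L2 (\<lambda>_. complex_of_real g * (LINT y|unit_leb. rep_L2 \<phi> y))"
    by (simp add: abs_L2_scaleC square_integrable_const mult.left_commute)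
  show "norm (abs_L2 (\<lambda>_. complex_of_real g * (LINT y|unit_leb. rep_L2 \<phi> y)))
      \<le> norm \<phi> * (2 * \<bar>g\<bar>)"
    using mult_left_mono[OF cmod_integral_le[of \<phi>], of "\<bar>g\<bar>"]
    by (simp add: norm_abs_L2_const norm_mult mult_ac)
qed

lemma op_A0_eq:
  assumes "u \<in> Linfty unit_leb" "H \<in> Linfty unit_leb"
  shows "op_A0 g u H p =
    (abs_L2 (\<lambda>x. complex_of_real (u x) * rep_L2 (fst p) x)
       + abs_L2 (\<lambda>x. complex_of_real (H x) * rep_L2 (snd p) x),
     abs_L2 (\<lambda>_. complex_of_real g * (LINT y|unit_leb. rep_L2 (fst p) y))
       + abs_L2 (\<lambda>x. complex_of_real (u x) * rep_L2 (snd p) x))"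
  by (simp add: op_A0_def case_prod_beta abs_L2_add square_integrable_const
      square_integrable_Linfty_mult square_integrable_rep assms)

lemma bounded_clinear_op_A0:
  assumes "u \<in> Linfty unit_leb" "H \<in> Linfty unit_leb"
  shows "bounded_clinear (op_A0 g u H)"
proof -
  note pieces = bounded_clinear_mult[OF assms(1)] bounded_clinear_mult[OF assms(2)]
    bounded_clinear_mean[of g]
  note bl = pieces[unfolded bounded_clinear_def, THEN conjunct1]
  have cl: "\<And>c \<phi>. abs_L2 (\<lambda>x. complex_of_real (u x) * rep_L2 (c *\<^sub>C \<phi>) x) =
        c *\<^sub>C abs_L2 (\<lambda>x. complex_of_real (u x) * rep_L2 \<phi> x)"
      "\<And>c \<phi>. abs_L2 (\<lambda>x. complex_of_real (H x) * rep_L2 (c *\<^sub>C \<phi>) x) =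
        c *\<^sub>C abs_L2 (\<lambda>x. complex_of_real (H x) * rep_L2 \<phi> x)"
      "\<And>c \<phi>. abs_L2 (\<lambda>_. complex_of_real g * (LINT y|unit_leb. rep_L2 (c *\<^sub>C \<phi>) y)) =
        c *\<^sub>C abs_L2 (\<lambda>_. complex_of_real g * (LINT y|unit_leb. rep_L2 \<phi> y))"
    using pieces by (auto simp only: bounded_clinear_def)
  have "bounded_linear (op_A0 g u H)"
    unfolding op_A0_eq[OF assms, abs_def]
    by (intro bounded_linear_Pair bounded_linear_add
        bounded_linear_compose[OF bl(1) bounded_linear_fst]
        bounded_linear_compose[OF bl(2) bounded_linear_snd]
        bounded_linear_compose[OF bl(3) bounded_linear_fst]
        bounded_linear_compose[OF bl(1) bounded_linear_snd])
  moreover have "op_A0 g u H (c *\<^sub>C p) = c *\<^sub>C op_A0 g u H p" for c p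
    by (simp only: op_A0_eq[OF assms] scaleC_prod_def fst_conv snd_conv cl scaleC_add_right)
  ultimately show ?thesis by (simp add: bounded_clinear_def)
qed

end

theory Submission
  imports Defs
begin

text \<open>Off the essential range the function \<open>u - c\<close> is essentially bounded away from zero, so
  \<open>A\<^sub>0 - c\<close> is block upper triangular with invertible diagonal, up to the rank one term
  \<open>g \<integral> \<phi>\<^sub>1\<close>. Back substitution in terms of the scalar \<open>s = \<integral> \<phi>\<^sub>1\<close> reduces
  \<open>(A\<^sub>0 - c) \<phi> = f\<close> to one scalar equation \<open>s (1 - \<kappa>) = \<rho> f\<close>, where \<open>\<rho>\<close> is a bounded functional
  and \<open>\<kappa>\<close> is the integral of \<open>g H / (c - u)\<^sup>2\<close>: for \<open>\<kappa> \<noteq> 1\<close> there is a bounded inverse, for \<open>\<kappa> = 1\<close> kernel and cokernel have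
  dimension one.

  For \<open>c\<close> in the essential range, the second component of the range of \<open>A\<^sub>0 - c\<close> lies in the
  range of multiplication by \<open>u - c\<close> plus the constants. The range of such a multiplication
  has infinite codimension: choose disjoint sets \<open>F\<^sub>k\<close> of positive measure on which
  \<open>\<bar>u - c\<bar> < 2\<^sup>-\<^sup>k\<close>, let \<open>f\<close> take the value \<open>2\<^sup>-\<^sup>k / sqrt \<bar>F\<^sub>k\<bar>\<close> on \<open>F\<^sub>k\<close>, and restrict \<open>f\<close> to
  the unions of the \<open>F\<^sub>k\<close> over infinitely many disjoint infinite sets of indices. These
  restrictions are square integrable, but no nontrivial combination of them remains so after
  division by \<open>u - c\<close>.\<close>

section \<open>Rank one perturbations of triangular block operators\<close>

lemma bounded_clinearD:
  assumes "bounded_clinear A"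
  shows "bounded_linear A" "A (c *\<^sub>C x) = c *\<^sub>C A x" "A (x + y) = A x + A y"
    "A (x - y) = A x - A y" "A (- x) = - A x" "A 0 = 0"
proof -
  show b: "bounded_linear A" and "A (c *\<^sub>C x) = c *\<^sub>C A x"
    using assms by (auto simp: bounded_clinear_def)
  then interpret bounded_linear A by simp
  show "A (x + y) = A x + A y" "A (x - y) = A x - A y" "A (- x) = - A x" "A 0 = 0"
    by (simp_all add: add diff neg zero)
qed

lemma bounded_linear_scaleC_left:
  "bounded_linear (\<lambda>c. c *\<^sub>C (x :: 'a :: complex_normed_vector))"
proof (rule bounded_linear_intro[where K = "norm x"])
  show "(r *\<^sub>R c) *\<^sub>C x = r *\<^sub>R (c *\<^sub>C x)" for r c
    by (simp add: scaleR_conv_of_real scaleC_of_real[symmetric] scaleC_scaleC)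
qed (simp_all add: scaleC_add_left norm_scaleC)

lemma invertible_imp_fredholm:
  assumes "invertible_op A"
  shows "fredholm_op A"
proof -
  obtain B where A: "bounded_clinear A" and B: "bounded_clinear B"
    and BA: "\<And>x. B (A x) = x" and AB: "\<And>y. A (B y) = y"
    using assms by (auto simp: invertible_op_def)
  have "x = 0" if "A x = 0" for x
    using BA[of x] that bounded_clinearD(6)[OF B] by simp
  then have "{x. A x = 0} \<subseteq> cspan {}" by auto
  moreover have "range A = UNIV" by (metis AB surjI)
  moreover have "\<exists>x. \<exists>z \<in> cspan {}. y = A x + z" for y
    using AB[of y] by (intro exI[of _ "B y"] bexI[of _ 0]) auto
  ultimately show ?thesis
    using A unfolding fredholm_op_def
    by (intro conjI exI[of _ "{}"]) auto
qed

text \<open>In the application \<open>W\<close>, \<open>N\<close> and \<open>M\<close> multiply by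
  \<open>u - c\<close>, \<open>H\<close> and \<open>1 / (u - c)\<close>, \<open>\<mu>\<close> is the
  mean and \<open>v\<close> the constant function \<open>g\<close>. The algebra uses only that
  \<open>M\<close> inverts \<open>W\<close>.\<close>

locale rank_one_block =
  fixes W N M :: "'a :: complex_normed_vector \<Rightarrow> 'a" and \<mu> :: "'a \<Rightarrow> complex" and v :: 'a
  assumes W: "bounded_clinear W" and N: "bounded_clinear N" and M: "bounded_clinear M"
    and \<mu>: "bounded_linear \<mu>" "\<And>c x. \<mu> (c *\<^sub>C x) = c * \<mu> x"
    and WM: "\<And>x. W (M x) = x" and MW: "\<And>x. M (W x) = x"
begin

definition T :: "'a \<times> 'a \<Rightarrow> 'a \<times> 'a"
  where "T p = (W (fst p) + N (snd p), \<mu> (fst p) *\<^sub>C v + W (snd p))"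

definition \<kappa> :: complex
  where "\<kappa> = \<mu> (M (N (M v)))"

definition \<rho> :: "'a \<times> 'a \<Rightarrow> complex"
  where "\<rho> p = \<mu> (M (fst p)) - \<mu> (M (N (M (snd p))))"

text \<open>The solution of \<open>T p = f\<close> by back substitution, given the value \<open>s\<close> of \<open>\<mu> (fst p)\<close>.\<close>

definition sol :: "complex \<Rightarrow> 'a \<times> 'a \<Rightarrow> 'a \<times> 'a"
  where "sol s f = (M (fst f) - M (N (M (snd f) - s *\<^sub>C M v)), M (snd f) - s *\<^sub>C M v)"

lemmas lin = bounded_clinearD(2-6)[OF W] bounded_clinearD(2-6)[OF N] bounded_clinearD(2-6)[OF M]
  \<mu>(2) linear_add[OF bounded_linear.linear[OF \<mu>(1)]]
  linear_diff[OF bounded_linear.linear[OF \<mu>(1)]]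

lemmas bl [THEN bounded_linear_compose] =
  bounded_clinearD(1)[OF W] bounded_clinearD(1)[OF N] bounded_clinearD(1)[OF M] \<mu>(1)

lemma bounded_clinear_T: "bounded_clinear T"
  unfolding bounded_clinear_def
proof
  show "bounded_linear T"
    unfolding T_def[abs_def]
    by (intro bounded_linear_Pair bounded_linear_add bl bounded_linear_fst bounded_linear_snd
        bounded_linear_compose[OF bounded_linear_scaleC_left])
  show "\<forall>c x. T (c *\<^sub>C x) = c *\<^sub>C T x"
    by (auto simp: T_def scaleC_prod_def lin scaleC_add_right scaleC_scaleC)
qed

lemma bounded_linear_\<rho>: "bounded_linear \<rho>"
  unfolding \<rho>_def[abs_def]
  by (intro bounded_linear_sub bl bounded_linear_fst bounded_linear_snd)

lemma \<rho>_scaleC: "\<rho> (c *\<^sub>C p) = c * \<rho> p"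
  by (simp add: \<rho>_def scaleC_prod_def lin right_diff_distrib)

text \<open>Back substitution presupposes the value \<open>s\<close>. It is consistent exactly if
  this expression equals \<open>s\<close>, the hypothesis of \<open>T_sol\<close>.\<close>

lemma \<mu>_sol: "\<mu> (fst (sol s f)) = \<rho> f + s * \<kappa>"
  by (simp add: sol_def \<rho>_def \<kappa>_def lin)

lemma T_sol:
  assumes "\<rho> f + s * \<kappa> = s"
  shows "T (sol s f) = f"
proof -
  have "T (sol s f) = (fst f, s *\<^sub>C v + W (snd (sol s f)))"
    using \<mu>_sol[of s f] assms by (simp add: T_def sol_def lin WM)
  then show ?thesis by (simp add: sol_def lin WM)
qed

text \<open>The scalar equation as a necessary condition: it gives injectivity for
  \<open>\<kappa> \<noteq> 1\<close> and confines the range to the kernel of \<open>\<rho>\<close>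
  for \<open>\<kappa> = 1\<close>.\<close>

lemma \<rho>_T: "\<rho> (T p) = \<mu> (fst p) * (1 - \<kappa>)"
  by (simp add: \<rho>_def T_def \<kappa>_def lin MW algebra_simps)

text \<open>Back substitution with right-hand side 0 is linear in the scalar, so the kernel is at
  most one-dimensional, whatever \<open>\<kappa>\<close> is.\<close>

lemma kernel_T:
  assumes "T p = 0"
  shows "p = \<mu> (fst p) *\<^sub>C sol 1 0"
proof -
  let ?s = "\<mu> (fst p)"
  have 1: "W (fst p) = - N (snd p)" and 2: "W (snd p) = - (?s *\<^sub>C v)"
    using assms by (simp_all add: T_def zero_prod_def eq_neg_iff_add_eq_0 add.commute)
  have s: "snd p = - (?s *\<^sub>C M v)"
    using MW[of "snd p"] 2 by (simp add: lin)
  have "fst p = - M (N (snd p))"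
    using MW[of "fst p"] 1 by (simp add: lin)
  also have "\<dots> = ?s *\<^sub>C M (N (M v))"
    by (subst s) (simp add: lin)
  finally show ?thesis
    using s by (intro prod_eqI) (simp_all add: sol_def scaleC_prod_def lin)
qed

section \<open>Invertibility and the Fredholm property, according to \<open>\<kappa>\<close>\<close>

lemma invertible_T:
  assumes "\<kappa> \<noteq> 1"
  shows "invertible_op T"
proof -
  \<comment> \<open>The quotient is the unique root \<open>s\<close> of
    \<open>\<rho> f + s * \<kappa> = s\<close>.\<close>
  define B where "B f = sol (\<rho> f / (1 - \<kappa>)) f" for f
  have "bounded_linear (\<lambda>f. \<rho> f / (1 - \<kappa>))"
    by (intro bounded_linear_compose[OF bounded_linear_divide] bounded_linear_\<rho>)
  then have "bounded_linear B"
    unfolding B_def[abs_def] sol_def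
    by (intro bounded_linear_Pair bounded_linear_sub bl bounded_linear_fst bounded_linear_snd
        bounded_linear_compose[OF bounded_linear_scaleC_left])
  moreover have "B (c *\<^sub>C f) = c *\<^sub>C B f" for c f
    unfolding B_def \<rho>_scaleC
    by (simp add: sol_def scaleC_prod_def lin scaleC_scaleC
        complex_vector.scale_right_diff_distrib)
  ultimately have B: "bounded_clinear B" by (simp add: bounded_clinear_def)
  have TB: "T (B f) = f" for f
    unfolding B_def using assms by (intro T_sol) (simp add: field_simps)
  have inj: "p = 0" if "T p = 0" for p
  proof -
    have "\<mu> (fst p) * (1 - \<kappa>) = 0"
      using \<rho>_T[of p] that linear_0[OF bounded_linear.linear[OF bounded_linear_\<rho>]] by simp
    then show "p = 0" using kernel_T[OF that] assms by simp
  qed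
  have "B (T p) = p" for p
  proof -
    \<comment> \<open>Injectivity turns the right inverse \<open>B\<close> into a left
      inverse.\<close>
    have "T (B (T p) - p) = 0"
      by (simp add: bounded_clinearD[OF bounded_clinear_T] TB)
    then show ?thesis using inj by fastforce
  qed
  then show ?thesis
    using bounded_clinear_T B TB by (auto simp: invertible_op_def)
qed

text \<open>For \<open>\<kappa> = 1\<close> the pair \<open>sol 1 0\<close> lies in the kernel, and
  it is nonzero because \<open>\<mu>\<close> of its first component is 1.\<close>

lemma not_invertible_T:
  assumes "\<kappa> = 1"
  shows "\<not> invertible_op T"
proof
  assume "invertible_op T"
  then obtain B where B: "\<And>x. B (T x) = x" by (auto simp: invertible_op_def)
  have "\<rho> 0 = 0" by (rule linear_0[OF bounded_linear.linear[OF bounded_linear_\<rho>]])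
  then have "T (sol 1 0) = 0" "\<mu> (fst (sol 1 0)) = 1"
    using T_sol[of 0 1] \<mu>_sol[of 1 0] assms by simp_all
  moreover have "T 0 = 0" using bounded_clinearD(6)[OF bounded_clinear_T] .
  ultimately have "sol 1 0 = 0" by (metis B)
  then show False
    using \<open>\<mu> (fst (sol 1 0)) = 1\<close> linear_0[OF bounded_linear.linear[OF \<mu>(1)]] by simp
qed

lemma fredholm_T:
  assumes "\<kappa> = 1"
  shows "fredholm_op T"
  unfolding fredholm_op_def
proof (intro conjI)
  show "bounded_clinear T" by (rule bounded_clinear_T)
  have "{x. T x = 0} \<subseteq> cspan {sol 1 0}"
    using kernel_T by (auto simp: complex_vector.span_singleton)
  then show "\<exists>K. finite K \<and> {x. T x = 0} \<subseteq> cspan K" by blast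
  have T_sol_0: "T (sol 0 f) = f" if "\<rho> f = 0" for f
    using T_sol[of f 0] that by simp
  \<comment> \<open>One inclusion is \<open>\<rho>_T\<close> with \<open>1 - \<kappa> = 0\<close>;
    for the other, \<open>s = 0\<close> is consistent as soon as \<open>\<rho> f = 0\<close>.
    Continuity of \<open>\<rho>\<close> then closes the range.\<close>
  have "range T = {f. \<rho> f = 0}"
    using T_sol_0 \<rho>_T assms by (auto intro: rangeI) (metis rangeI)
  also have "closed \<dots>"
    by (intro closed_Collect_eq linear_continuous_on bounded_linear_\<rho> continuous_on_const)
  finally show "closed (range T)" .
  \<comment> \<open>Since \<open>\<rho>\<close> does not vanish at \<open>(0, v)\<close>, this
    vector spans a complement of the kernel of \<open>\<rho>\<close>.\<close>
  have \<rho>_v: "\<rho> (0, v) = - 1"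
    using assms linear_0[OF bounded_linear.linear[OF \<mu>(1)]] by (simp add: \<rho>_def \<kappa>_def lin)
  have "\<exists>x. \<exists>z \<in> cspan {(0, v)}. y = T x + z" for y
  proof (intro exI bexI)
    let ?z = "(- \<rho> y) *\<^sub>C (0, v)"
    show "?z \<in> cspan {(0, v)}" by (intro complex_vector.span_scale complex_vector.span_base) simp
    have "\<rho> (y - ?z) = 0"
      using linear_diff[OF bounded_linear.linear[OF bounded_linear_\<rho>]] \<rho>_v
      by (simp only: \<rho>_scaleC) simp
    then show "y = T (sol 0 (y - ?z)) + ?z" by (simp only: T_sol_0) simp
  qed
  then show "\<exists>C. finite C \<and> (\<forall>y. \<exists>x. \<exists>z \<in> cspan C. y = T x + z)"
    by (intro exI[of _ "{(0, v)}"]) auto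
qed

end


section \<open>Multiplication operators\<close>

text \<open>\<open>Linfty\<close> contains real functions only, whereas \<open>u - c\<close> and its
  reciprocal are complex.\<close>

definition ess_bounded :: "(real \<Rightarrow> complex) \<Rightarrow> bool"
  where "ess_bounded h \<longleftrightarrow>
    h \<in> borel_measurable unit_leb \<and> (\<exists>b. AE x in unit_leb. cmod (h x) \<le> b)"

lemma ess_bounded_measurable [measurable_dest]:
  "ess_bounded h \<Longrightarrow> h \<in> borel_measurable unit_leb"
  by (simp add: ess_bounded_def)

lemma ess_bounded_Linfty:
  assumes "h \<in> Linfty unit_leb"
  shows "ess_bounded (\<lambda>x. complex_of_real (h x))"
proof -
  have [measurable]: "h \<in> borel_measurable unit_leb"
    using assms by (simp add: Linfty_def)
  obtain b where "AE x in unit_leb. \<bar>h x\<bar> \<le> b"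
    using Linfty_bounded[OF assms] .
  then show ?thesis by (auto simp: ess_bounded_def)
qed

lemma ess_bounded_const: "ess_bounded (\<lambda>_. c)"
  by (auto simp: ess_bounded_def)

lemma ess_bounded_diff:
  assumes "ess_bounded h" "ess_bounded k"
  shows "ess_bounded (\<lambda>x. h x - k x)"
proof -
  note [measurable] = assms
  obtain b c where "AE x in unit_leb. cmod (h x) \<le> b" "AE x in unit_leb. cmod (k x) \<le> c"
    using assms by (auto simp: ess_bounded_def)
  then have "AE x in unit_leb. cmod (h x - k x) \<le> b + c"
    by eventually_elim (use norm_triangle_ineq4 in \<open>smt (verit)\<close>)
  then show ?thesis by (auto simp: ess_bounded_def)
qed

lemma square_integrable_mult:
  assumes h: "ess_bounded h" and f: "square_integrable f"
  shows "square_integrable (\<lambda>x. h x * f x)"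
proof -
  note [measurable] = h
  have [measurable]: "f \<in> borel_measurable unit_leb"
    using f by (simp add: square_integrable_def)
  obtain b where b: "AE x in unit_leb. cmod (h x) \<le> b"
    using h by (auto simp: ess_bounded_def)
  show ?thesis
  proof (rule square_integrable_bound[OF f, where b = b])
    show "AE x in unit_leb. cmod (h x * f x) \<le> b * cmod (f x)"
      using b by eventually_elim (simp add: norm_mult mult_right_mono)
  qed measurable
qed

lemma L2_eqI:
  assumes "AE x in unit_leb. rep_L2 \<phi> x = rep_L2 \<psi> x"
  shows "\<phi> = \<psi>"
  using abs_L2_eqI[OF square_integrable_rep square_integrable_rep assms] by (simp add: abs_rep_L2)

definition mult_L2 :: "(real \<Rightarrow> complex) \<Rightarrow> L2 \<Rightarrow> L2"
  where "mult_L2 h \<phi> = abs_L2 (\<lambda>x. h x * rep_L2 \<phi> x)"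

lemma rep_mult_L2:
  assumes "ess_bounded h"
  shows "AE x in unit_leb. rep_L2 (mult_L2 h \<phi>) x = h x * rep_L2 \<phi> x"
  unfolding mult_L2_def
  by (intro rep_abs_L2 square_integrable_mult square_integrable_rep assms)

text \<open>Reduces identities between classes to almost everywhere identities between the chosen
  representatives.\<close>

lemma mult_L2_eqI:
  assumes "ess_bounded h" "AE x in unit_leb. rep_L2 \<psi> x = h x * rep_L2 \<phi> x"
  shows "mult_L2 h \<phi> = \<psi>"
proof (rule L2_eqI)
  show "AE x in unit_leb. rep_L2 (mult_L2 h \<phi>) x = rep_L2 \<psi> x"
    using rep_mult_L2[OF assms(1)] assms(2) by eventually_elim simp
qed

lemma mult_L2_diff:
  assumes "ess_bounded h" "ess_bounded k"
  shows "mult_L2 (\<lambda>x. h x - k x) \<phi> = mult_L2 h \<phi> - mult_L2 k \<phi>"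
proof (rule mult_L2_eqI[OF ess_bounded_diff[OF assms]])
  \<comment> \<open>The rule for representatives of sums is applied to
    \<open>(a - b) + b = a\<close>.\<close>
  have "AE x in unit_leb. rep_L2 (mult_L2 h \<phi>) x =
      rep_L2 (mult_L2 h \<phi> - mult_L2 k \<phi>) x + rep_L2 (mult_L2 k \<phi>) x"
    using rep_L2_add[of "mult_L2 h \<phi> - mult_L2 k \<phi>" "mult_L2 k \<phi>"] by simp
  then show "AE x in unit_leb. rep_L2 (mult_L2 h \<phi> - mult_L2 k \<phi>) x =
      (h x - k x) * rep_L2 \<phi> x"
    using rep_mult_L2[OF assms(1), of \<phi>] rep_mult_L2[OF assms(2), of \<phi>]
    by eventually_elim (simp add: algebra_simps)
qed

lemma mult_L2_const: "mult_L2 (\<lambda>_. c) \<phi> = c *\<^sub>C \<phi>"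
  by (rule mult_L2_eqI[OF ess_bounded_const rep_L2_scaleC])

lemma mult_L2_mult_L2:
  assumes "ess_bounded h" "ess_bounded k" "AE x in unit_leb. h x * k x = 1"
  shows "mult_L2 h (mult_L2 k \<phi>) = \<phi>"
proof (rule mult_L2_eqI[OF assms(1)])
  show "AE x in unit_leb. rep_L2 \<phi> x = h x * rep_L2 (mult_L2 k \<phi>) x"
    using rep_mult_L2[OF assms(2), of \<phi>] assms(3)
  proof eventually_elim
    case (elim x)
    then have "h x * rep_L2 (mult_L2 k \<phi>) x = h x * k x * rep_L2 \<phi> x" by simp
    then show ?case using elim by simp
  qed
qed

lemma bounded_clinear_mult_L2:
  assumes h: "ess_bounded h"
  shows "bounded_clinear (mult_L2 h)"
proof -
  obtain b where b: "AE x in unit_leb. cmod (h x) \<le> b"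
    using h by (auto simp: ess_bounded_def)
  note rep = rep_mult_L2[OF h]
  show ?thesis
  proof (rule bounded_clinearI[where K = "\<bar>b\<bar>"])
    fix \<phi> \<psi> :: L2 and c
    show "mult_L2 h (\<phi> + \<psi>) = mult_L2 h \<phi> + mult_L2 h \<psi>"
    proof (rule mult_L2_eqI[OF h])
      show "AE x in unit_leb. rep_L2 (mult_L2 h \<phi> + mult_L2 h \<psi>) x = h x * rep_L2 (\<phi> + \<psi>) x"
        using rep_L2_add[of \<phi> \<psi>] rep_L2_add[of "mult_L2 h \<phi>" "mult_L2 h \<psi>"]
          rep[of \<phi>] rep[of \<psi>]
        by eventually_elim (simp add: distrib_left)
    qed
    show "mult_L2 h (c *\<^sub>C \<phi>) = c *\<^sub>C mult_L2 h \<phi>"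
    proof (rule mult_L2_eqI[OF h])
      show "AE x in unit_leb. rep_L2 (c *\<^sub>C mult_L2 h \<phi>) x = h x * rep_L2 (c *\<^sub>C \<phi>) x"
        using rep_L2_scaleC[of c \<phi>] rep_L2_scaleC[of c "mult_L2 h \<phi>"] rep[of \<phi>]
        by eventually_elim simp
    qed
    have i: "integrable unit_leb (\<lambda>x. (cmod (rep_L2 \<eta> x))\<^sup>2)" for \<eta>
      using square_integrable_rep[of \<eta>] by (simp add: square_integrable_def)
    have "(LINT x|unit_leb. (cmod (rep_L2 (mult_L2 h \<phi>) x))\<^sup>2)
        \<le> (LINT x|unit_leb. \<bar>b\<bar>\<^sup>2 * (cmod (rep_L2 \<phi> x))\<^sup>2)"
    proof (intro integral_mono_AE integrable_mult_right i)
      show "AE x in unit_leb. (cmod (rep_L2 (mult_L2 h \<phi>) x))\<^sup>2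
          \<le> \<bar>b\<bar>\<^sup>2 * (cmod (rep_L2 \<phi> x))\<^sup>2"
        using b rep[of \<phi>]
      proof eventually_elim
        case (elim x)
        then have "(cmod (h x))\<^sup>2 \<le> \<bar>b\<bar>\<^sup>2" by (intro power_mono) auto
        then show ?case
          unfolding elim(2) norm_mult power_mult_distrib
          by (intro mult_right_mono zero_le_power2)
      qed
    qed
    then have "(norm (mult_L2 h \<phi>))\<^sup>2 \<le> (norm \<phi> * \<bar>b\<bar>)\<^sup>2"
      by (simp add: norm_L2_eq power_mult_distrib mult.commute)
    then show "norm (mult_L2 h \<phi>) \<le> norm \<phi> * \<bar>b\<bar>"
      by (meson norm_ge_zero mult_nonneg_nonneg abs_ge_zero power2_le_imp_le)
  qed
qed

section \<open>The mean functional and the block form of the operator\<close>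

definition mean_L2 :: "L2 \<Rightarrow> complex"
  where "mean_L2 \<phi> = (LINT x|unit_leb. rep_L2 \<phi> x)"

lemma mean_L2_eq:
  assumes "AE x in unit_leb. rep_L2 \<phi> x = f x" "f \<in> borel_measurable unit_leb"
  shows "mean_L2 \<phi> = (LINT x|unit_leb. f x)"
  unfolding mean_L2_def using assms square_integrable_rep[of \<phi>]
  by (intro integral_cong_AE) (auto simp: square_integrable_def)

lemma mean_L2_scaleC: "mean_L2 (c *\<^sub>C \<phi>) = c * mean_L2 \<phi>"
proof -
  have "mean_L2 (c *\<^sub>C \<phi>) = (LINT x|unit_leb. c * rep_L2 \<phi> x)"
    using square_integrable_cmult[OF square_integrable_rep[of \<phi>], of c]
    by (intro mean_L2_eq rep_L2_scaleC) (simp add: square_integrable_def)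
  then show ?thesis by (simp add: mean_L2_def)
qed

lemma bounded_linear_mean_L2: "bounded_linear mean_L2"
proof (rule bounded_linear_intro[where K = 2])
  fix \<phi> \<psi> :: L2 and r :: real
  have i: "integrable unit_leb (rep_L2 \<eta>)" for \<eta>
    by (intro square_integrable_integrable square_integrable_rep)
  have "mean_L2 (\<phi> + \<psi>) = (LINT x|unit_leb. rep_L2 \<phi> x + rep_L2 \<psi> x)"
    by (intro mean_L2_eq rep_L2_add borel_measurable_add borel_measurable_integrable i)
  then show "mean_L2 (\<phi> + \<psi>) = mean_L2 \<phi> + mean_L2 \<psi>"
    by (simp add: mean_L2_def i)
  show "mean_L2 (r *\<^sub>R \<phi>) = r *\<^sub>R mean_L2 \<phi>"
    by (simp add: scaleC_of_real[symmetric] mean_L2_scaleC scaleR_conv_of_real)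
  show "norm (mean_L2 \<phi>) \<le> norm \<phi> * 2"
    using cmod_integral_le[of \<phi>] by (simp add: mean_L2_def)
qed

text \<open>Exhibits \<open>A\<^sub>0 - c\<close> in the form of \<open>T\<close> in
  \<open>rank_one_block\<close>.\<close>

lemma op_A0_minus_eq:
  assumes u: "u \<in> Linfty unit_leb" and H: "H \<in> Linfty unit_leb"
  shows "op_A0 g u H p - c *\<^sub>C p =
    (mult_L2 (\<lambda>x. complex_of_real (u x) - c) (fst p) +
       mult_L2 (\<lambda>x. complex_of_real (H x)) (snd p),
     mean_L2 (fst p) *\<^sub>C abs_L2 (\<lambda>_. complex_of_real g) +
       mult_L2 (\<lambda>x. complex_of_real (u x) - c) (snd p))"
  unfolding op_A0_eq[OF assms] mult_L2_diff[OF ess_bounded_Linfty[OF u] ess_bounded_const]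
    mult_L2_const
  by (simp add: mult_L2_def mean_L2_def scaleC_prod_def abs_L2_scaleC square_integrable_const
      mult.commute)

section \<open>The spectrum off the essential range\<close>

lemma essential_range_complement:
  assumes "u \<in> borel_measurable unit_leb"
    and "c \<notin> complex_of_real ` essential_range unit_leb u"
  obtains \<delta> where "\<delta> > 0" "AE x in unit_leb. \<delta> \<le> cmod (complex_of_real (u x) - c)"
proof (cases "Im c = 0")
  case False
  \<comment> \<open>As \<open>u\<close> is real, a nonreal \<open>c\<close> stays at distance at
    least \<open>\<bar>Im c\<bar>\<close> from all its values.\<close>
  have "\<bar>Im c\<bar> \<le> cmod (complex_of_real (u x) - c)" for x
    using abs_Im_le_cmod[of "complex_of_real (u x) - c"] by simp
  then show ?thesis using False by (intro that[of "\<bar>Im c\<bar>"]) auto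
next
  case True
  then have c: "c = complex_of_real (Re c)" by (simp add: complex_eq_iff)
  then have "Re c \<notin> essential_range unit_leb u" using assms(2) by (metis imageI)
  then obtain \<epsilon> where \<epsilon>: "\<epsilon> > 0" "emeasure unit_leb {x \<in> space unit_leb. \<bar>u x - Re c\<bar> < \<epsilon>} = 0"
    by (auto simp: essential_range_def)
  note [measurable] = assms(1)
  have "{x \<in> space unit_leb. \<bar>u x - Re c\<bar> < \<epsilon>} \<in> sets unit_leb" by measurable
  then have "AE x in unit_leb. \<not> \<bar>u x - Re c\<bar> < \<epsilon>"
    by (intro AE_I[OF _ \<epsilon>(2)]) auto
  moreover have "cmod (complex_of_real (u x) - c) = \<bar>u x - Re c\<bar>" for x
    by (subst c) (simp only: of_real_diff[symmetric] norm_of_real)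
  ultimately show ?thesis using \<epsilon>(1) by (intro that[of \<epsilon>]) auto
qed

lemma spectrum_off_essential_range:
  fixes g :: real
  assumes u: "u \<in> Linfty unit_leb" and H: "H \<in> Linfty unit_leb"
    and c: "c \<notin> complex_of_real ` essential_range unit_leb u"
  defines "K \<equiv> LINT x|unit_leb. complex_of_real (g * H x) / (c - complex_of_real (u x))\<^sup>2"
  shows "fredholm_op (\<lambda>p. op_A0 g u H p - c *\<^sub>C p)"
    and "invertible_op (\<lambda>p. op_A0 g u H p - c *\<^sub>C p) \<longleftrightarrow> K \<noteq> 1"
proof -
  have [measurable]: "u \<in> borel_measurable unit_leb" "H \<in> borel_measurable unit_leb"
    using u H by (auto simp: Linfty_def)
  obtain \<delta> where \<delta>: "\<delta> > 0" "AE x in unit_leb. \<delta> \<le> cmod (complex_of_real (u x) - c)"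
    using essential_range_complement[OF _ c] by auto
  define w where "w x = complex_of_real (u x) - c" for x
  \<comment> \<open>Where \<open>w\<close> vanishes this is 0 by convention, which happens only on a
    null set.\<close>
  define m where "m x = 1 / w x" for x
  define h where "h x = complex_of_real (H x)" for x
  define v where "v = abs_L2 (\<lambda>_. complex_of_real g)"
  have w: "ess_bounded w" and h: "ess_bounded h"
    unfolding w_def[abs_def] h_def[abs_def]
    by (intro ess_bounded_diff ess_bounded_Linfty ess_bounded_const u H)+
  have "AE x in unit_leb. cmod (m x) \<le> 1 / \<delta>"
    using \<delta>(2) \<delta>(1)
    by (auto simp: m_def w_def norm_divide elim!: eventually_mono
        intro!: divide_left_mono mult_pos_pos)
  then have m: "ess_bounded m"
    by (auto simp: ess_bounded_def m_def[abs_def] w_def[abs_def])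
  have wm: "AE x in unit_leb. w x * m x = 1"
    using \<delta>(2) \<delta>(1) by (auto simp: m_def w_def elim!: eventually_mono)
  then have mw: "AE x in unit_leb. m x * w x = 1" by (simp add: mult.commute)
  interpret rank_one_block "mult_L2 w" "mult_L2 h" "mult_L2 m" mean_L2 v
    by (intro rank_one_block.intro bounded_clinear_mult_L2 w h m bounded_linear_mean_L2
        mean_L2_scaleC mult_L2_mult_L2 wm mw)
  have T: "(\<lambda>p. op_A0 g u H p - c *\<^sub>C p) = T"
    unfolding op_A0_minus_eq[OF u H] T_def[abs_def]
    by (simp add: v_def w_def[abs_def] h_def[abs_def])
  \<comment> \<open>The composition multiplies the constant \<open>g\<close> by
    \<open>H / (u - c)\<^sup>2\<close>, and the square absorbs the sign of
    \<open>u - c\<close>.\<close>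
  have "\<kappa> = K"
    unfolding \<kappa>_def K_def
  proof (rule mean_L2_eq)
    have "AE x in unit_leb. rep_L2 v x = complex_of_real g"
      unfolding v_def by (intro rep_abs_L2 square_integrable_const)
    then show "AE x in unit_leb. rep_L2 (mult_L2 m (mult_L2 h (mult_L2 m v))) x =
        complex_of_real (g * H x) / (c - complex_of_real (u x))\<^sup>2"
      using rep_mult_L2[OF m, of v] rep_mult_L2[OF h, of "mult_L2 m v"]
        rep_mult_L2[OF m, of "mult_L2 h (mult_L2 m v)"]
      by eventually_elim
        (simp add: m_def w_def h_def power2_eq_square minus_divide_divide algebra_simps)
  qed measurable
  then show "fredholm_op (\<lambda>p. op_A0 g u H p - c *\<^sub>C p)"
    and "invertible_op (\<lambda>p. op_A0 g u H p - c *\<^sub>C p) \<longleftrightarrow> K \<noteq> 1"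
    unfolding T using fredholm_T invertible_T not_invertible_T invertible_imp_fredholm by metis+
qed


section \<open>Multiplication by a function with essential infimum zero\<close>

text \<open>Linear dependence of an indexed family, which may repeat vectors. A repetition gives the
  coefficients 1 and -1; an injective family has too many vectors to be independent in a finite
  span.\<close>

lemma finite_span_dependent_family:
  fixes z :: "nat \<Rightarrow> 'a :: complex_normed_vector"
  assumes C: "finite C" and z: "\<And>n. z n \<in> cspan C"
  obtains J a j where "finite J" "j \<in> J" "a j \<noteq> 0" "(\<Sum>i\<in>J. a i *\<^sub>C z i) = 0"
proof (cases "inj z")
  case False
  then obtain i j where ij: "z i = z j" "i \<noteq> j" by (auto simp: inj_on_def)
  show ?thesis
    by (rule that[of "{i, j}" i "(\<lambda>_. - 1)(i := 1)"])
      (use ij in \<open>auto simp: complex_vector.scale_minus_left scaleC_one\<close>)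
next
  case True
  then have "infinite (range z)" by (simp add: finite_image_iff)
  then have "complex_vector.dependent (range z)"
    using complex_vector.independent_span_bound[OF C] z by blast
  then obtain S c v where S: "finite S" "S \<subseteq> range z" "(\<Sum>v\<in>S. c v *\<^sub>C v) = 0" "v \<in> S" "c v \<noteq> 0"
    unfolding complex_vector.dependent_explicit by blast
  obtain j where "v = z j" using S by auto
  have "(\<Sum>i\<in>z -` S. c (z i) *\<^sub>C z i) = (\<Sum>v\<in>z ` (z -` S). c v *\<^sub>C v)"
    using True by (subst sum.reindex) (auto intro: inj_on_subset)
  also have "z ` (z -` S) = S" using S(2) by auto
  finally show ?thesis
    using S True \<open>v = z j\<close>
    by (intro that[of "z -` S" j "\<lambda>i. c (z i)"]) (auto intro: finite_vimageI)
qed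

lemma snd_in_cspan:
  assumes "p \<in> cspan C"
  shows "snd p \<in> cspan (snd ` C)"
proof -
  have "complex_vector.subspace {p. snd p \<in> cspan (snd ` C)}"
    by (rule complex_vector.subspaceI)
      (auto simp: scaleC_prod_def intro: complex_vector.span_add complex_vector.span_scale
        complex_vector.span_zero)
  then have "cspan C \<subseteq> {p. snd p \<in> cspan (snd ` C)}"
    by (intro complex_vector.span_minimal) (auto intro: complex_vector.span_base)
  then show ?thesis using assms by auto
qed

section \<open>Disjoint sets of positive measure\<close>

lemma emeasure_unit_leb_eq: "emeasure unit_leb A = ennreal (measure unit_leb A)"
  by (rule finite_measure.emeasure_eq_measure[OF finite_measure_unit_leb])

text \<open>Nonatomicity: countably many intervals of length \<open>\<epsilon>\<close> cover the
  line, and if each met \<open>S\<close> in a null set, \<open>S\<close> would be null.\<close>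

lemma small_subset:
  assumes S: "S \<in> sets unit_leb" "measure unit_leb S > 0" and \<epsilon>: "\<epsilon> > 0"
  obtains E where "E \<in> sets unit_leb" "E \<subseteq> S" "0 < measure unit_leb E" "measure unit_leb E \<le> \<epsilon>"
proof (rule ccontr)
  assume no: "\<not> thesis"
  define I where "I i = {real_of_int i * \<epsilon> ..< real_of_int i * \<epsilon> + \<epsilon>}" for i
  have SI: "S \<inter> I i \<in> sets unit_leb" for i
  proof -
    have "S \<inter> I i = S \<inter> ({0<..<1} \<inter> I i)"
      using sets.sets_into_space[OF S(1)] by auto
    moreover have "{0<..<1} \<inter> I i \<in> sets unit_leb"
      by (auto simp: sets_restrict_space I_def)
    ultimately show ?thesis using S(1) by (simp only: sets.Int)
  qed
  have "measure unit_leb (S \<inter> I i) = 0" for i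
  proof (rule ccontr)
    assume n: "measure unit_leb (S \<inter> I i) \<noteq> 0"
    have "emeasure unit_leb (S \<inter> I i) = emeasure lebesgue (S \<inter> I i)"
      using sets.sets_into_space[OF SI[of i]] by (intro emeasure_restrict_space) auto
    also have "\<dots> \<le> emeasure lebesgue (I i)"
      by (intro emeasure_mono) (auto simp: I_def)
    also have "\<dots> = ennreal \<epsilon>" using \<epsilon> by (simp add: I_def)
    finally have "measure unit_leb (S \<inter> I i) \<le> \<epsilon>"
      using \<epsilon> by (simp add: emeasure_unit_leb_eq)
    then show False
      using no that[OF SI[of i]] n by (simp add: zero_less_measure_iff)
  qed
  then have "S \<inter> I i \<in> null_sets unit_leb" for i
    using SI by (auto intro!: null_setsI simp: emeasure_unit_leb_eq)
  then have "(\<Union>i. S \<inter> I i) \<in> null_sets unit_leb"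
    by (intro null_sets_UN') auto
  moreover have "S \<subseteq> (\<Union>i. S \<inter> I i)"
  proof
    fix x assume "x \<in> S"
    have "x \<in> I \<lfloor>x / \<epsilon>\<rfloor>"
      using \<epsilon> floor_divide_lower[of \<epsilon> x] floor_divide_upper[of \<epsilon> x]
      by (auto simp: I_def algebra_simps)
    then show "x \<in> (\<Union>i. S \<inter> I i)" using \<open>x \<in> S\<close> by auto
  qed
  ultimately have "S \<in> null_sets unit_leb" using S(1) null_sets_subset by blast
  then show False using S(2) by (simp add: null_sets_def emeasure_unit_leb_eq)
qed

text \<open>The sets \<open>G k\<close> may be nested. Choose subsets \<open>E k\<close> whose
  measures decay so fast that removing all later ones from \<open>E k\<close> leaves positive
  measure.\<close>

lemma disjoint_subsets_positive_measure:
  assumes G: "\<And>k :: nat. G k \<in> sets unit_leb" "\<And>k. measure unit_leb (G k) > 0"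
  obtains F where "disjoint_family F" "\<And>k. F k \<in> sets unit_leb" "\<And>k. F k \<subseteq> G k"
    "\<And>k. measure unit_leb (F k) > 0"
proof -
  interpret finite_measure unit_leb by (rule finite_measure_unit_leb)
  have "\<exists>E. \<forall>k. (E k \<in> sets unit_leb \<and> E k \<subseteq> G k \<and> 0 < measure unit_leb (E k)) \<and>
      measure unit_leb (E (Suc k)) \<le> measure unit_leb (E k) / 4"
  proof (rule dependent_nat_choice)
    show "\<exists>E. E \<in> sets unit_leb \<and> E \<subseteq> G 0 \<and> 0 < measure unit_leb E"
      using G by blast
    fix E k assume E: "E \<in> sets unit_leb \<and> E \<subseteq> G k \<and> 0 < measure unit_leb E"
    then have "measure unit_leb E / 4 > 0" by simp
    obtain E' where "E' \<in> sets unit_leb" "E' \<subseteq> G (Suc k)" "0 < measure unit_leb E'"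
      "measure unit_leb E' \<le> measure unit_leb E / 4"
      by (rule small_subset[OF G(1) G(2) \<open>measure unit_leb E / 4 > 0\<close>])
    then show "\<exists>E'. (E' \<in> sets unit_leb \<and> E' \<subseteq> G (Suc k) \<and> 0 < measure unit_leb E') \<and>
        measure unit_leb E' \<le> measure unit_leb E / 4"
      by blast
  qed
  then obtain E where E: "\<And>k. E k \<in> sets unit_leb" "\<And>k. E k \<subseteq> G k"
    "\<And>k. 0 < measure unit_leb (E k)"
    "\<And>k. measure unit_leb (E (Suc k)) \<le> measure unit_leb (E k) / 4" by blast
  have decay: "measure unit_leb (E (k + n)) \<le> measure unit_leb (E k) * (1 / 4) ^ n" for k n
  proof (induction n)
    case (Suc n)
    then show ?case using E(4)[of "k + n"] by simp
  qed simp
  define U where "U k = (\<Union>n. E (Suc k + n))" for k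
  have U: "U k \<in> sets unit_leb" for k using E(1) by (auto simp: U_def)
  have mU: "measure unit_leb (U k) < measure unit_leb (E k)" for k
  proof -
    \<comment> \<open>The ratio 1/4 makes the later sets weigh at most 1/4 + 1/16 + ... = 1/3 of
      \<open>E k\<close>.\<close>
    let ?b = "\<lambda>n. measure unit_leb (E k) / 4 * (1 / 4) ^ n"
    have b: "measure unit_leb (E (Suc k + n)) \<le> ?b n" for n
      using decay[of k "Suc n"] by simp
    have sb: "summable ?b" by (intro summable_mult summable_geometric) simp
    have s: "summable (\<lambda>n. measure unit_leb (E (Suc k + n)))"
      using b by (intro summable_comparison_test'[OF sb]) simp
    have "measure unit_leb (U k) \<le> (\<Sum>n. measure unit_leb (E (Suc k + n)))"
      unfolding U_def using E(1) s by (intro finite_measure_subadditive_countably) auto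
    also have "\<dots> \<le> (\<Sum>n. ?b n)" using b s sb by (intro suminf_le) auto
    also have "\<dots> = measure unit_leb (E k) / 3"
      by (subst suminf_mult) (auto simp: suminf_geometric)
    finally show ?thesis using E(3)[of k] by linarith
  qed
  define F where "F k = E k - U k" for k
  have "measure unit_leb (F k) > 0" for k
  proof -
    have "measure unit_leb (E k) \<le> measure unit_leb (F k \<union> U k)"
      using E(1) U by (intro finite_measure_mono) (auto simp: F_def)
    also have "\<dots> \<le> measure unit_leb (F k) + measure unit_leb (U k)"
      using E(1) U by (intro measure_Un_le) (auto simp: F_def)
    finally show ?thesis using mU[of k] by linarith
  qed
  moreover have "disjoint_family F"
  proof -
    have "F i \<inter> F j = {}" if "i < j" for i j
    proof -
      have "E j \<subseteq> U i" using that by (auto simp: U_def intro!: exI[of _ "j - Suc i"])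
      then show ?thesis by (auto simp: F_def)
    qed
    then show ?thesis
      unfolding disjoint_family_on_def by (metis inf_commute linorder_neqE_nat)
  qed
  ultimately show ?thesis
    using E(1,2) U by (intro that[of F]) (auto simp: F_def)
qed

section \<open>Square integrability over disjoint sets\<close>

lemma step_function_square_integrable:
  assumes F: "disjoint_family F" "\<And>k. F k \<in> sets unit_leb"
    and b: "\<And>k. b k \<ge> 0" and s: "summable (\<lambda>k. (b k)\<^sup>2 * measure unit_leb (F k))"
  obtains f where "square_integrable f" "\<And>k x. x \<in> F k \<Longrightarrow> f x = complex_of_real (b k)"
proof -
  note [measurable] = F(2)
  \<comment> \<open>In \<open>ennreal\<close> the series converges everywhere, so \<open>q\<close>
    is measurable at once; by disjointness at most one term is nonzero at each point.\<close>
  define q where "q x = (\<Sum>k. ennreal (b k) * indicator (F k) x)" for x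
  define f where "f x = complex_of_real (enn2real (q x))" for x
  have fF: "f x = complex_of_real (b k)" if "x \<in> F k" for k x
    using suminf_cmult_indicator[OF F(1) that, of "\<lambda>k. ennreal (b k)"] b[of k]
    by (simp add: f_def q_def)
  have f0: "f x = 0" if "\<And>k. x \<notin> F k" for x
    using that by (simp add: f_def q_def)
  have [measurable]: "f \<in> borel_measurable unit_leb"
    unfolding f_def[abs_def] q_def by measurable
  have le: "ennreal ((cmod (f x))\<^sup>2) \<le> (\<Sum>k. ennreal ((b k)\<^sup>2) * indicator (F k) x)" for x
  proof (cases "\<exists>k. x \<in> F k")
    case True
    then obtain k where "x \<in> F k" by blast
    then show ?thesis
      using suminf_cmult_indicator[OF F(1) \<open>x \<in> F k\<close>, of "\<lambda>k. ennreal ((b k)\<^sup>2)"] fF b by simp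
  qed (use f0 in simp)
  have "(\<integral>\<^sup>+x. ennreal ((cmod (f x))\<^sup>2) \<partial>unit_leb)
      \<le> (\<integral>\<^sup>+x. (\<Sum>k. ennreal ((b k)\<^sup>2) * indicator (F k) x) \<partial>unit_leb)"
    by (intro nn_integral_mono le)
  also have "\<dots> = (\<Sum>k. ennreal ((b k)\<^sup>2) * emeasure unit_leb (F k))"
    by (subst nn_integral_suminf) (auto simp: nn_integral_cmult_indicator F(2))
  also have "\<dots> = (\<Sum>k. ennreal ((b k)\<^sup>2 * measure unit_leb (F k)))"
    by (simp add: emeasure_unit_leb_eq ennreal_mult)
  also have "\<dots> < \<infinity>"
    using s by (subst suminf_ennreal2) auto
  finally have "square_integrable f"
    unfolding square_integrable_def by (auto intro!: integrableI_bounded)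
  then show ?thesis using that fF by blast
qed

text \<open>Each of the infinitely many disjoint sets contributes at least \<open>d\<close> to the
  integral of the squared modulus.\<close>

lemma not_square_integrable_disjoint:
  assumes F: "disjoint_family F" "\<And>k :: nat. F k \<in> sets unit_leb" "\<And>k. measure unit_leb (F k) > 0"
    and d: "d > 0"
    and f: "\<And>k. AE x in unit_leb. x \<in> F k \<longrightarrow> d / measure unit_leb (F k) \<le> (cmod (f x))\<^sup>2"
  shows "\<not> square_integrable f"
proof
  assume "square_integrable f"
  then have fin: "(\<integral>\<^sup>+x. ennreal ((cmod (f x))\<^sup>2) \<partial>unit_leb) < \<infinity>"
    by (auto simp: square_integrable_def integrable_iff_bounded)
  note [measurable] = F(2)
  let ?c = "\<lambda>k. ennreal (d / measure unit_leb (F k))"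
  have "(\<integral>\<^sup>+x. (\<Sum>k. ?c k * indicator (F k) x) \<partial>unit_leb)
      \<le> (\<integral>\<^sup>+x. ennreal ((cmod (f x))\<^sup>2) \<partial>unit_leb)"
  proof (rule nn_integral_mono_AE)
    have "AE x in unit_leb. \<forall>k. x \<in> F k \<longrightarrow> d / measure unit_leb (F k) \<le> (cmod (f x))\<^sup>2"
      using f by (simp add: AE_all_countable)
    then show "AE x in unit_leb. (\<Sum>k. ?c k * indicator (F k) x) \<le> ennreal ((cmod (f x))\<^sup>2)"
    proof eventually_elim
      case (elim x)
      show ?case
      proof (cases "\<exists>k. x \<in> F k")
        case True
        then obtain k where "x \<in> F k" by blast
        then show ?thesis
          using suminf_cmult_indicator[OF F(1) \<open>x \<in> F k\<close>, of ?c] elim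
          by (auto intro: ennreal_leI)
      qed simp
    qed
  qed
  also have "(\<integral>\<^sup>+x. (\<Sum>k. ?c k * indicator (F k) x) \<partial>unit_leb)
      = (\<Sum>k. ?c k * emeasure unit_leb (F k))"
    by (subst nn_integral_suminf) (auto simp: nn_integral_cmult_indicator F(2))
  also have "\<dots> = (\<Sum>k :: nat. ennreal d)"
  proof (intro suminf_cong)
    show "?c k * emeasure unit_leb (F k) = ennreal d" for k
      using F(3)[of k] d unfolding emeasure_unit_leb_eq
      by (subst ennreal_mult'[symmetric]) auto
  qed
  also have "\<dots> = \<infinity>"
  proof (rule ccontr)
    assume "(\<Sum>k :: nat. ennreal d) \<noteq> \<infinity>"
    then have "summable (\<lambda>k :: nat. d)"
      using d by (intro summable_suminf_not_top) auto
    then have "d = 0" by (rule summable_const_iff[THEN iffD1])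
    then show False using d by simp
  qed
  finally show False using fin by simp
qed

section \<open>Infinite codimension and failure of the Fredholm property\<close>

lemma rep_L2_sum:
  assumes "finite J"
  shows "AE x in unit_leb. rep_L2 (\<Sum>j\<in>J. \<phi> j) x = (\<Sum>j\<in>J. rep_L2 (\<phi> j) x)"
  using assms
proof (induction J rule: finite_induct)
  case empty
  show ?case using rep_abs_L2[OF square_integrable_0] by (simp add: zero_L2_def)
next
  case (insert i J)
  show ?case
    using rep_L2_add[of "\<phi> i" "\<Sum>j\<in>J. \<phi> j"] insert.IH
    by eventually_elim (simp add: insert.hyps)
qed

text \<open>With a finite complement, infinitely many functions would have their remainders in one
  finite span. A relation among the remainders puts a nontrivial combination of the functions into
  the range, which their construction excludes.\<close>

lemma range_mult_L2_infinite_codim: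
  assumes h: "ess_bounded h"
    and small: "\<And>\<epsilon>. \<epsilon> > 0 \<Longrightarrow> emeasure unit_leb {x \<in> space unit_leb. cmod (h x) < \<epsilon>} \<noteq> 0"
    and C: "finite C"
  shows "\<exists>\<psi>. \<forall>\<phi>. \<forall>z \<in> cspan C. \<psi> \<noteq> mult_L2 h \<phi> + z"
proof (rule ccontr)
  assume "\<not> ?thesis"
  then have all: "\<exists>\<phi> z. z \<in> cspan C \<and> \<psi> = mult_L2 h \<phi> + z" for \<psi> by blast
  note [measurable] = h
  note lin = bounded_clinearD[OF bounded_clinear_mult_L2[OF h]]
  define G where "G k = {x \<in> space unit_leb. cmod (h x) < (1 / 2) ^ k}" for k :: nat
  have G: "G k \<in> sets unit_leb" for k unfolding G_def by measurable
  have "measure unit_leb (G k) > 0" for k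
    using small[of "(1 / 2) ^ k"] unfolding G_def emeasure_unit_leb_eq
    by (simp add: zero_less_measure_iff)
  with G obtain F where F: "disjoint_family F" "\<And>k. F k \<in> sets unit_leb" "\<And>k. F k \<subseteq> G k"
    "\<And>k. measure unit_leb (F k) > 0"
    using disjoint_subsets_positive_measure[of G] by blast
  \<comment> \<open>The squared integral over \<open>F k\<close> is then \<open>(1 / 4) ^ k\<close>,
    which is summable, while division by a factor below \<open>(1 / 2) ^ k\<close> leaves a squared
    integral of at least 1.\<close>
  define b where "b k = (1 / 2) ^ k / sqrt (measure unit_leb (F k))" for k
  have b0: "b k > 0" for k using F(4) by (simp add: b_def)
  have b2: "(b k)\<^sup>2 * measure unit_leb (F k) = (1 / 4) ^ k" for k
  proof -
    have "((1 / 2 :: real) ^ k)\<^sup>2 = (1 / 4) ^ k"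
      by (simp add: power2_eq_square power_mult_distrib[symmetric])
    then show ?thesis using F(4)[of k] by (simp add: b_def power_divide power_mult_distrib)
  qed
  \<comment> \<open>Pair decoding splits the indices into infinitely many disjoint infinite classes,
    one for each \<open>r\<close>.\<close>
  define \<beta> where "\<beta> r k = (if fst (prod_decode k) = r then b k else 0)" for r k
  have "\<exists>f. square_integrable f \<and> (\<forall>k. \<forall>x\<in>F k. f x = complex_of_real (\<beta> r k))" for r
  proof -
    have "summable (\<lambda>k. (\<beta> r k)\<^sup>2 * measure unit_leb (F k))"
    proof (rule summable_comparison_test')
      show "summable (\<lambda>k. (1 / 4 :: real) ^ k)" by (rule summable_geometric) simp
      show "norm ((\<beta> r k)\<^sup>2 * measure unit_leb (F k)) \<le> (1 / 4) ^ k" for k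
        by (simp add: \<beta>_def b2)
    qed
    moreover have "\<beta> r k \<ge> 0" for k using b0 by (simp add: \<beta>_def less_imp_le)
    ultimately show ?thesis
      using step_function_square_integrable[OF F(1,2)] by metis
  qed
  then obtain f where f: "\<And>r. square_integrable (f r)"
    "\<And>r k x. x \<in> F k \<Longrightarrow> f r x = complex_of_real (\<beta> r k)" by metis
  have "\<forall>r. \<exists>\<phi> z. z \<in> cspan C \<and> abs_L2 (f r) = mult_L2 h \<phi> + z"
    using all by blast
  then obtain \<phi> z where z: "\<And>r. z r \<in> cspan C"
    and fz: "\<And>r. abs_L2 (f r) = mult_L2 h (\<phi> r) + z r"
    unfolding choice_iff by blast
  obtain J a j where J: "finite J" "j \<in> J" "a j \<noteq> 0" "(\<Sum>r\<in>J. a r *\<^sub>C z r) = 0"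
    by (rule finite_span_dependent_family[OF C z])
  define \<Phi> where "\<Phi> = (\<Sum>r\<in>J. a r *\<^sub>C \<phi> r)"
  have "(\<Sum>r\<in>J. a r *\<^sub>C abs_L2 (f r)) = (\<Sum>r\<in>J. mult_L2 h (a r *\<^sub>C \<phi> r) + a r *\<^sub>C z r)"
    by (simp add: fz scaleC_add_right lin)
  also have "\<dots> = mult_L2 h \<Phi>"
    by (simp add: \<Phi>_def sum.distrib J(4) linear_sum[OF bounded_linear.linear[OF lin(1)]])
  finally have eq: "(\<Sum>r\<in>J. abs_L2 (\<lambda>x. a r * f r x)) = mult_L2 h \<Phi>"
    by (simp add: abs_L2_scaleC f(1))
  have "AE x in unit_leb. \<forall>r\<in>J. rep_L2 (abs_L2 (\<lambda>x. a r * f r x)) x = a r * f r x"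
    by (intro AE_finite_allI J(1) rep_abs_L2 square_integrable_cmult f(1))
  then have ae: "AE x in unit_leb. (\<Sum>r\<in>J. a r * f r x) = h x * rep_L2 \<Phi> x"
    using rep_L2_sum[OF J(1), of "\<lambda>r. abs_L2 (\<lambda>x. a r * f r x)"] rep_mult_L2[OF h, of \<Phi>]
    by eventually_elim (simp add: eq)
  \<comment> \<open>Enumerates class \<open>j\<close>. On these sets all \<open>f r\<close> with
    \<open>r \<noteq> j\<close> vanish, so the term with \<open>a j \<noteq> 0\<close> cannot
    cancel.\<close>
  define k where "k i = prod_encode (j, i)" for i
  have "inj k" by (auto simp: inj_on_def k_def)
  have "\<not> square_integrable (rep_L2 \<Phi>)"
  proof (rule not_square_integrable_disjoint[where F = "\<lambda>i. F (k i)" and d = "(cmod (a j))\<^sup>2"])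
    show "disjoint_family (\<lambda>i. F (k i))"
      using F(1) \<open>inj k\<close> by (auto simp: disjoint_family_on_def inj_on_def)
    fix i
    show "AE x in unit_leb. x \<in> F (k i) \<longrightarrow>
        (cmod (a j))\<^sup>2 / measure unit_leb (F (k i)) \<le> (cmod (rep_L2 \<Phi> x))\<^sup>2"
      using ae
    proof eventually_elim
      case (elim x)
      show ?case
      proof
        assume x: "x \<in> F (k i)"
        have "(\<Sum>r\<in>J. a r * f r x) = (\<Sum>r\<in>J. if r = j then a j * complex_of_real (b (k i)) else 0)"
          by (intro sum.cong) (auto simp: f(2)[OF x] \<beta>_def k_def)
        also have "\<dots> = a j * complex_of_real (b (k i))"
          using J by (simp add: sum.delta)
        finally have "cmod (a j) * b (k i) = cmod (h x) * cmod (rep_L2 \<Phi> x)"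
          using elim b0[of "k i"] by (metis norm_mult norm_of_real abs_of_pos)
        \<comment> \<open>The factor \<open>(1 / 2) ^ k i\<close> cancels against the one in
          \<open>b\<close>; zeros of \<open>h\<close> do no harm, as nothing is divided by
          \<open>h\<close>.\<close>
        also have "\<dots> \<le> (1 / 2) ^ k i * cmod (rep_L2 \<Phi> x)"
          using x F(3)[of "k i"] by (intro mult_right_mono) (auto simp: G_def)
        finally have "cmod (a j) / sqrt (measure unit_leb (F (k i))) \<le> cmod (rep_L2 \<Phi> x)"
          by (simp add: b_def field_simps)
        then have "(cmod (a j) / sqrt (measure unit_leb (F (k i))))\<^sup>2 \<le> (cmod (rep_L2 \<Phi> x))\<^sup>2"
          using F(4)[of "k i"] by (intro power_mono) auto
        then show "(cmod (a j))\<^sup>2 / measure unit_leb (F (k i)) \<le> (cmod (rep_L2 \<Phi> x))\<^sup>2"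
          by (simp add: power_divide)
      qed
    qed
  qed (use F J in auto)
  then show False using square_integrable_rep by blast
qed

lemma not_fredholm_on_essential_range:
  assumes u: "u \<in> Linfty unit_leb" and H: "H \<in> Linfty unit_leb"
    and r: "r \<in> essential_range unit_leb u"
  shows "\<not> fredholm_op (\<lambda>p. op_A0 g u H p - complex_of_real r *\<^sub>C p)"
proof
  let ?T = "\<lambda>p. op_A0 g u H p - complex_of_real r *\<^sub>C p"
  let ?w = "\<lambda>x. complex_of_real (u x) - complex_of_real r"
  let ?v = "abs_L2 (\<lambda>_. complex_of_real g)"
  assume "fredholm_op ?T"
  then obtain C where C: "finite C" "\<And>y. \<exists>x. \<exists>z \<in> cspan C. y = ?T x + z"
    unfolding fredholm_op_def by blast
  have w: "ess_bounded ?w"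
    by (intro ess_bounded_diff ess_bounded_Linfty ess_bounded_const u)
  have "cmod (?w x) = \<bar>u x - r\<bar>" for x
    by (simp only: of_real_diff[symmetric] norm_of_real)
  then have "emeasure unit_leb {x \<in> space unit_leb. cmod (?w x) < \<epsilon>} \<noteq> 0" if "\<epsilon> > 0" for \<epsilon>
    using r that by (simp add: essential_range_def)
  from range_mult_L2_infinite_codim[OF w this, of "insert ?v (snd ` C)"] C(1)
  obtain \<psi> where \<psi>: "\<And>\<phi> z. z \<in> cspan (insert ?v (snd ` C)) \<Longrightarrow> \<psi> \<noteq> mult_L2 ?w \<phi> + z"
    by blast
  obtain p z where z: "z \<in> cspan C" and p: "(0, \<psi>) = ?T p + z" using C(2) by blast
  have "snd z \<in> cspan (insert ?v (snd ` C))"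
    using snd_in_cspan[OF z] complex_vector.span_mono[of "snd ` C" "insert ?v (snd ` C)"] by auto
  then have "mean_L2 (fst p) *\<^sub>C ?v + snd z \<in> cspan (insert ?v (snd ` C))"
    by (intro complex_vector.span_add complex_vector.span_scale)
      (auto intro: complex_vector.span_base)
  moreover have "\<psi> = mult_L2 ?w (snd p) + (mean_L2 (fst p) *\<^sub>C ?v + snd z)"
    using arg_cong[OF p, of snd] unfolding op_A0_minus_eq[OF u H] by (simp add: ac_simps)
  ultimately show False using \<psi> by blast
qed

theorem corollary4p2:
  fixes g :: real and u H :: "real \<Rightarrow> real"
  assumes "g > 0"
    and "u \<in> Linfty unit_leb" and "H \<in> Linfty unit_leb"
    and "essinf unit_leb H > 0"
  shows "discrete_spectrum (op_A0 g u H) =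
      {c \<in> UNIV - complex_of_real ` essential_range unit_leb u.
        (LINT x|unit_leb. complex_of_real (g * H x) / (c - complex_of_real (u x))\<^sup>2) = 1}
    \<and> essential_spectrum (op_A0 g u H) = complex_of_real ` essential_range unit_leb u"
proof -
  \<comment> \<open>This settles the essential spectrum; the discrete spectrum is then
    non-invertibility off the essential range, which the integral decides.\<close>
  have "fredholm_op (\<lambda>p. op_A0 g u H p - c *\<^sub>C p) \<longleftrightarrow>
      c \<notin> complex_of_real ` essential_range unit_leb u" for c
    using spectrum_off_essential_range(1)[OF assms(2,3)]
      not_fredholm_on_essential_range[OF assms(2,3)] by blast
  then show ?thesis
    unfolding discrete_spectrum_def essential_spectrum_def
    using spectrum_off_essential_range(2)[OF assms(2,3), of _ g] by auto
qed

end
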